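(* For all (possibly empty) permutations $\rho_1,\rho_2,\rho_3,\rho_4$, where $\rho_i$ is a permutation of $\{1,\dots,n_i\}$ with $n_i\ge 0$, $$N(\rho_1\Vert\rho_2\Vert\rho_3\Vert\rho_4)=N(\rho_1\Vert\rho_3\Vert\rho_2\Vert\rho_4).$$
   Context: Permutations are composed from right to left; $(i\ j)$ denotes the transposition exchanging $i$ and $j$, and $(i\ i)$ denotes the identity. The multiplicity $N(\pi)$ of a permutation $\pi$ of $\{1,\dots,n\}$ is the number of sequences $(a_1,\dots,a_n)\in\{1,\dots,n\}^n$ with $\pi=(n\ a_n)\cdots(2\ a_2)(1\ a_1)$. If $\pi$ is a permutation of $\{1,\dots,n\}$ and $\rho$ is a permutation of $\{1,\dots,m\}$, their concatenation $\pi\Vert\rho$ is the permutation of $\{1,\dots,m+n\}$ with $(\pi\Vert\rho)(j)=\pi(j)$ for $1\le j\le n$ and $(\pi\Vert\rho)(j)=n+\rho(j-n)$ for $n+1\le j\le m+n$. Concatenation is associative. *)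

theory Defs
  imports "HOL-Combinatorics.Permutations" "HOL-Library.FuncSet"
begin

text \<open>A permutation of \<open>{1, \<dots>, n}\<close> is a function \<open>p\<close> on the naturals with \<open>p permutes {1..n}\<close>;
  in particular it is the identity outside \<open>{1..n}\<close>. The size \<open>n\<close> is not determined by \<open>p\<close>
  and is passed explicitly.\<close>

text \<open>\<open>transp_prod a k = (k a\<^sub>k) \<cdots> (2 a\<^sub>2) (1 a\<^sub>1)\<close>, where \<open>(1 a\<^sub>1)\<close> is applied first.\<close>

primrec transp_prod :: "(nat \<Rightarrow> nat) \<Rightarrow> nat \<Rightarrow> nat \<Rightarrow> nat" where
  "transp_prod a 0 = id"
| "transp_prod a (Suc k) = transpose (Suc k) (a (Suc k)) \<circ> transp_prod a k"

text \<open>Sequences \<open>(a\<^sub>1, \<dots>, a\<^sub>n)\<close> are extensional functions on \<open>{1..n}\<close>, so that each is counted once.\<close>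

definition multiplicity_perm :: "nat \<Rightarrow> (nat \<Rightarrow> nat) \<Rightarrow> nat" where
  "multiplicity_perm n p = card {a \<in> {1..n} \<rightarrow>\<^sub>E {1..n}. p = transp_prod a n}"

text \<open>Concatenation of a permutation \<open>p\<close> of \<open>{1..n}\<close> with a permutation \<open>r\<close> of \<open>{1..m}\<close>. The size \<open>m\<close>
  is not needed: beyond \<open>n + m\<close> the second branch is the identity because \<open>r\<close> is the identity
  beyond \<open>m\<close>.\<close>

definition perm_concat :: "nat \<Rightarrow> (nat \<Rightarrow> nat) \<Rightarrow> (nat \<Rightarrow> nat) \<Rightarrow> nat \<Rightarrow> nat" where
  "perm_concat n p r j = (if j \<le> n then p j else n + r (j - n))"

lemma perm_concat_permutes:
  assumes p: "p permutes {1..n}" and r: "r permutes {1..m}"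
  shows "perm_concat n p r permutes {1..n + m}"
proof (rule bij_imp_permutes)
  have pn: "p j \<le> n" if "j \<le> n" for j
    using permutes_in_image[OF p, of j] permutes_not_in[OF p, of j] that by (cases "j = 0") auto
  have p0: "1 \<le> p j" if "1 \<le> j" "j \<le> n" for j
    using permutes_in_image[OF p, of j] that by auto
  have rm: "1 \<le> r (j - n) \<and> r (j - n) \<le> m" if "\<not> j \<le> n" "j \<le> n + m" for j
  proof -
    have "j - n \<in> {1..m}" using that by auto
    then show ?thesis using permutes_in_image[OF r, of "j - n"] by auto
  qed
  have inj: "inj_on (perm_concat n p r) {1..n + m}"
  proof (rule inj_onI)
    fix x y assume xy: "x \<in> {1..n + m}" "y \<in> {1..n + m}" "perm_concat n p r x = perm_concat n p r y"
    have iff: "perm_concat n p r z \<le> n \<longleftrightarrow> z \<le> n" if "z \<in> {1..n + m}" for z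
      using that pn[of z] rm[of z] by (cases "z \<le> n") (auto simp: perm_concat_def)
    show "x = y"
    proof (cases "x \<le> n")
      case True
      moreover have "y \<le> n" using True iff[of x] iff[of y] xy by simp
      ultimately show ?thesis
        using xy(3) permutes_inj[OF p] by (simp add: perm_concat_def inj_eq)
    next
      case False
      moreover have "\<not> y \<le> n" using False iff[of x] iff[of y] xy by simp
      ultimately show ?thesis
        using xy(3) permutes_inj[OF r] by (simp add: perm_concat_def inj_eq)
    qed
  qed
  have sub: "perm_concat n p r ` {1..n + m} \<subseteq> {1..n + m}"
  proof
    fix y assume "y \<in> perm_concat n p r ` {1..n + m}"
    then obtain x where x: "x \<in> {1..n + m}" "y = perm_concat n p r x" by blast
    show "y \<in> {1..n + m}"
      using x pn[of x] p0[of x] rm[of x] by (auto simp: perm_concat_def)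
  qed
  show "bij_betw (perm_concat n p r) {1..n + m} {1..n + m}"
    using inj endo_inj_surj[OF _ sub inj] by (simp add: bij_betw_def)
next
  fix x assume x: "x \<notin> {1..n + m}"
  show "perm_concat n p r x = x"
  proof (cases "x = 0")
    case True
    then show ?thesis using permutes_not_in[OF p, of 0] by (simp add: perm_concat_def)
  next
    case False
    then have "n + m < x" using x by auto
    moreover from this have "x - n \<notin> {1..m}" by auto
    ultimately show ?thesis
      using permutes_not_in[OF r, of "x - n"] by (simp add: perm_concat_def)
  qed
qed

lemma perm_concat_assoc:
  shows "perm_concat (n + m) (perm_concat n p q) r = perm_concat n p (perm_concat m q r)"
  by (auto simp: perm_concat_def fun_eq_iff)

end

theory Submission
  imports Defs
begin

text \<open>A sequence \<open>a\<close> is read as a functional graph with one edge from each \<open>k\<close> to \<open>a k\<close>, the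
  transposition along the edge at \<open>k\<close> being performed at time \<open>k\<close>. Every connected component \<open>W\<close> of
  this graph is invariant under the product \<open>\<pi>\<close>, and since \<open>W\<close> carries only as many edges as
  vertices, it consists of at most two cycles of \<open>\<pi>\<close> (\<open>card_invariant_sets_component\<close>): joining two
  components costs a cycle, and only the one edge that closes a circuit can split one.

  Relabelling the points turns the two sides into counts of sequences with the same product \<open>\<pi>\<close>, in
  which the edges leaving four \<open>\<pi>\<close>-invariant blocks \<open>B\<^sub>1\<close>, \<open>B\<^sub>2\<close>, \<open>B\<^sub>3\<close>, \<open>B\<^sub>4\<close> are performed in the
  block order 1, 2, 3, 4 and 1, 3, 2, 4 respectively. Let \<open>A\<^sub>i\<close> be the partial product for \<open>B\<^sub>i\<close>, and
  let \<open>C\<close> and \<open>D\<close> be the restrictions of \<open>\<pi>\<close> to \<open>B\<^sub>2\<close> and \<open>B\<^sub>3\<close>. If there were no other blocks, then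
  \<open>A\<^sub>3 A\<^sub>2 = C D\<close> would be equivalent to \<open>(D A\<^sub>2 D\<inverse>) (C\<inverse> A\<^sub>3 C) = C D\<close>. Here \<open>D A\<^sub>2 D\<inverse>\<close> is again a
  product of edges leaving \<open>B\<^sub>2\<close> in the same order, because \<open>D\<close> fixes \<open>B\<^sub>2\<close> pointwise, and likewise
  for \<open>C\<inverse> A\<^sub>3 C\<close>. So twisting the edges between \<open>B\<^sub>2\<close> and \<open>B\<^sub>3\<close> by \<open>D\<close> and \<open>C\<inverse>\<close> exchanges the two
  orders.

  The same twist works with all four blocks (\<open>twisted_product\<close>), by inspecting one component \<open>W\<close> at a
  time. If \<open>W\<close> misses \<open>B\<^sub>2\<close> or \<open>B\<^sub>3\<close>, one of the two factors is trivial on \<open>W\<close> and their order is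
  irrelevant. If \<open>W\<close> meets both, the two cycles of \<open>W\<close> are thereby used up, so \<open>W\<close> lies inside
  \<open>B\<^sub>2 \<union> B\<^sub>3\<close>, where the two-block computation applies.\<close>

section \<open>Products of transpositions along a list\<close>

primrec swap_prod :: "('a \<Rightarrow> 'a) \<Rightarrow> 'a list \<Rightarrow> 'a \<Rightarrow> 'a" where
  "swap_prod a [] = id"
| "swap_prod a (k # ks) = swap_prod a ks \<circ> transpose k (a k)"

lemma swap_prod_append: "swap_prod a (ks @ ls) = swap_prod a ls \<circ> swap_prod a ks"
  by (induction ks) (simp_all add: comp_assoc)

lemma transp_prod_eq_swap_prod: "transp_prod a n = swap_prod a [1..<Suc n]"
  by (induction n) (simp_all add: swap_prod_append)

lemma bij_swap_prod: "bij (swap_prod a ks)"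
proof (induction ks)
  case (Cons k ks)
  then show ?case
    unfolding swap_prod.simps by (intro bij_comp) auto
qed (simp add: bij_id[unfolded id_def] id_def)

lemma swap_prod_cong:
  "(\<And>k. k \<in> set ks \<Longrightarrow> a k = b k) \<Longrightarrow> swap_prod a ks = swap_prod b ks"
  by (induction ks) simp_all

text \<open>Conjugating a transposition applies the conjugating map to both of its points. This gives the
  invariance under relabelling, and also the twist, where \<open>f\<close> fixes \<open>ks\<close> pointwise.\<close>

lemma swap_prod_conj:
  assumes f: "inj f" and b: "\<And>k. k \<in> set ks \<Longrightarrow> b (f k) = f (a k)"
  shows "swap_prod b (map f ks) (f x) = f (swap_prod a ks x)"
  using b
proof (induction ks arbitrary: x)
  case (Cons k ks)
  have "transpose (f k) (b (f k)) (f x) = f (transpose k (a k) x)"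
    using Cons.prems[of k] f by (auto simp: transpose_def inj_eq)
  then show ?case using Cons by simp
qed simp

lemma swap_prod_mem_closed_iff:
  assumes "\<And>k. k \<in> set ks \<Longrightarrow> k \<in> W \<longleftrightarrow> a k \<in> W"
  shows "swap_prod a ks x \<in> W \<longleftrightarrow> x \<in> W"
  using assms
proof (induction ks arbitrary: x)
  case (Cons k ks)
  have "transpose k (a k) x \<in> W \<longleftrightarrow> x \<in> W"
    using Cons.prems[of k] by (auto simp: transpose_def)
  then show ?case using Cons by simp
qed simp

lemma swap_prod_fixes_closed:
  assumes "\<And>k. k \<in> set ks \<Longrightarrow> k \<notin> W \<and> a k \<notin> W" and "x \<in> W"
  shows "swap_prod a ks x = x"
  using assms
proof (induction ks)
  case (Cons k ks)
  have "transpose k (a k) x = x"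
    using Cons.prems by (auto simp: transpose_def)
  then show ?case using Cons by simp
qed simp

section \<open>A component carries at most two cycles\<close>

text \<open>Cycles and components are counted through the families of sets that they generate: a
  permutation of \<open>W\<close> with \<open>c\<close> cycles has \<open>2\<^sup>c\<close> invariant subsets, a graph with \<open>c\<close> components has
  \<open>2\<^sup>c\<close> subsets closed under adjacency.\<close>

definition invariant_sets :: "'a set \<Rightarrow> ('a \<Rightarrow> 'a) \<Rightarrow> 'a set set" where
  "invariant_sets W p = {X \<in> Pow W. \<forall>x. p x \<in> X \<longleftrightarrow> x \<in> X}"

definition closed_sets :: "'a set \<Rightarrow> ('a \<Rightarrow> 'a) \<Rightarrow> 'a list \<Rightarrow> 'a set set" where
  "closed_sets W a ks = {X \<in> Pow W. \<forall>k\<in>set ks. k \<in> X \<longleftrightarrow> a k \<in> X}"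

text \<open>The condition \<open>u \<in> X \<longleftrightarrow> v \<in> X\<close> is a linear equation over the field with two elements, so
  its solutions have index two unless it holds identically.\<close>

lemma card_sym_diff_closed_half:
  assumes fin: "finite F"
    and sd: "\<And>X Y. X \<in> F \<Longrightarrow> Y \<in> F \<Longrightarrow> sym_diff X Y \<in> F"
    and K: "K \<in> F" "\<not> (u \<in> K \<longleftrightarrow> v \<in> K)"
  shows "card F = 2 * card {X \<in> F. u \<in> X \<longleftrightarrow> v \<in> X}"
proof -
  let ?G = "{X \<in> F. u \<in> X \<longleftrightarrow> v \<in> X}" and ?H = "{X \<in> F. \<not> (u \<in> X \<longleftrightarrow> v \<in> X)}"
  have inv: "sym_diff (sym_diff X K) K = X" for X
    by blast
  have "bij_betw (\<lambda>X. sym_diff X K) ?G ?H"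
  proof (rule bij_betw_byWitness[where f' = "\<lambda>X. sym_diff X K"])
    show "(\<lambda>X. sym_diff X K) ` ?G \<subseteq> ?H"
      using sd[OF _ K(1)] K(2) by auto
    show "(\<lambda>X. sym_diff X K) ` ?H \<subseteq> ?G"
      using sd[OF _ K(1)] K(2) by auto
  qed (use inv in auto)
  then have "card ?G = card ?H"
    by (rule bij_betw_same_card)
  moreover have "card F = card ?G + card ?H"
  proof -
    have "F = ?G \<union> ?H" by blast
    moreover have "card (?G \<union> ?H) = card ?G + card ?H"
      using fin by (intro card_Un_disjoint) auto
    ultimately show ?thesis by simp
  qed
  ultimately show ?thesis by simp
qed

lemma finite_invariant_sets: "finite W \<Longrightarrow> finite (invariant_sets W p)"
  by (simp add: invariant_sets_def)

lemma finite_closed_sets: "finite W \<Longrightarrow> finite (closed_sets W a ks)"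
  by (simp add: closed_sets_def)

lemma sym_diff_invariant_sets:
  "X \<in> invariant_sets W p \<Longrightarrow> Y \<in> invariant_sets W p \<Longrightarrow> sym_diff X Y \<in> invariant_sets W p"
  by (auto simp: invariant_sets_def)

lemma sym_diff_closed_sets:
  "X \<in> closed_sets W a ks \<Longrightarrow> Y \<in> closed_sets W a ks \<Longrightarrow> sym_diff X Y \<in> closed_sets W a ks"
  by (auto simp: closed_sets_def)

lemma closed_sets_invariant:
  "closed_sets W a ks \<subseteq> invariant_sets W (swap_prod a ks)"
  using swap_prod_mem_closed_iff[of ks _ a]
  by (auto simp: closed_sets_def invariant_sets_def)

lemma invariant_sets_comp_transpose:
  "{X \<in> invariant_sets W (p \<circ> transpose u v). u \<in> X \<longleftrightarrow> v \<in> X}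
   = {X \<in> invariant_sets W p. u \<in> X \<longleftrightarrow> v \<in> X}"
proof -
  have "(\<forall>x. p (transpose u v x) \<in> X \<longleftrightarrow> x \<in> X) \<longleftrightarrow> (\<forall>x. p x \<in> X \<longleftrightarrow> x \<in> X)"
    if uv: "u \<in> X \<longleftrightarrow> v \<in> X" for X
  proof -
    have t: "transpose u v x \<in> X \<longleftrightarrow> x \<in> X" for x
      using uv by (auto simp: transpose_def)
    show ?thesis
      by (metis t transpose_involutory)
  qed
  then show ?thesis
    by (auto simp: invariant_sets_def)
qed

lemma card_invariant_sets_comp_transpose_le:
  assumes W: "finite W"
  shows "card (invariant_sets W (p \<circ> transpose u v)) \<le> 2 * card (invariant_sets W p)"
proof -
  let ?I = "invariant_sets W (p \<circ> transpose u v)"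
  have "card ?I \<le> 2 * card {X \<in> ?I. u \<in> X \<longleftrightarrow> v \<in> X}"
  proof (cases "\<exists>K\<in>?I. \<not> (u \<in> K \<longleftrightarrow> v \<in> K)")
    case True
    then obtain K where K: "K \<in> ?I" "\<not> (u \<in> K \<longleftrightarrow> v \<in> K)" by blast
    show ?thesis
      using card_sym_diff_closed_half[OF finite_invariant_sets[OF W] sym_diff_invariant_sets K]
      by simp
  next
    case False
    then have "{X \<in> ?I. u \<in> X \<longleftrightarrow> v \<in> X} = ?I" by blast
    then show ?thesis by simp
  qed
  also have "\<dots> = 2 * card {X \<in> invariant_sets W p. u \<in> X \<longleftrightarrow> v \<in> X}"
    by (simp only: invariant_sets_comp_transpose)
  also have "\<dots> \<le> 2 * card (invariant_sets W p)"
    using finite_invariant_sets[OF W] by (simp add: card_mono)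
  finally show ?thesis .
qed

text \<open>A transposition joining two different cycles of \<open>p\<close> merges them. The set \<open>K\<close> exhibits the two
  cycles as different; the map \<open>p \<circ> transpose u v\<close> moves exactly one point out of \<open>K\<close> and one into
  it, so comparing the number of elements of \<open>X\<close> in \<open>K\<close> before and after forces these two points to
  be both in \<open>X\<close> or both outside.\<close>

lemma invariant_set_of_merge_aux:
  assumes p: "inj p" and fin: "finite K"
    and K: "\<And>x. p x \<in> K \<longleftrightarrow> x \<in> K"
    and uv: "u \<in> K" "v \<notin> K"
    and X: "\<And>x. p (transpose u v x) \<in> X \<longleftrightarrow> x \<in> X"
  shows "u \<in> X \<longleftrightarrow> v \<in> X"
proof -
  let ?Z = "{x \<in> K - {u}. p x \<in> X}"
  have finZ: "finite ?Z" using fin by simp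
  have "p ` K = K"
    using K fin p by (intro endo_inj_surj) (auto intro: inj_on_subset)
  then have image: "p ` {x \<in> K. p x \<in> X} = K \<inter> X"
    by auto
  have "card {x \<in> K. p (transpose u v x) \<in> X} = card (K \<inter> X)"
    by (rule arg_cong[where f = card]) (auto simp: X)
  also have "\<dots> = card {x \<in> K. p x \<in> X}"
    unfolding image[symmetric] using p by (simp add: card_image inj_on_subset)
  finally have eq: "card {x \<in> K. p (transpose u v x) \<in> X} = card {x \<in> K. p x \<in> X}" .
  have "{x \<in> K. p (transpose u v x) \<in> X} = (if p v \<in> X then insert u ?Z else ?Z)"
    using uv by (auto simp: transpose_def)
  moreover have "{x \<in> K. p x \<in> X} = (if p u \<in> X then insert u ?Z else ?Z)"
    using uv by auto
  ultimately have "p v \<in> X \<longleftrightarrow> p u \<in> X"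
    using eq finZ by (auto split: if_splits)
  then show ?thesis
    using X[of u] X[of v] by simp
qed

lemma invariant_set_of_merge:
  assumes p: "inj p" and fin: "finite W"
    and K: "K \<in> invariant_sets W p" "\<not> (u \<in> K \<longleftrightarrow> v \<in> K)"
    and X: "X \<in> invariant_sets W (p \<circ> transpose u v)"
  shows "u \<in> X \<longleftrightarrow> v \<in> X"
proof -
  have finK: "finite K" and Kp: "\<And>x. p x \<in> K \<longleftrightarrow> x \<in> K"
    using K(1) fin by (auto simp: invariant_sets_def intro: finite_subset)
  have Xp: "p (transpose u v x) \<in> X \<longleftrightarrow> x \<in> X" for x
    using X by (auto simp: invariant_sets_def)
  show ?thesis
  proof (cases "u \<in> K")
    case True
    then show ?thesis
      using invariant_set_of_merge_aux[OF p finK Kp _ _ Xp] K(2) by blast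
  next
    case False
    have "p (transpose v u x) \<in> X \<longleftrightarrow> x \<in> X" for x
      using Xp by (simp add: transpose_commute)
    then show ?thesis
      using invariant_set_of_merge_aux[OF p finK Kp, of v u X] K(2) False by blast
  qed
qed

text \<open>In terms of cycles and components this is the genus inequality
  \<open>cycles + vertices \<le> edges + 2 * components\<close> for products of transpositions: an edge joining two
  components merges two cycles, any other edge changes the number of cycles by at most one. Edges
  outside \<open>W\<close> do not count.\<close>

lemma card_invariant_sets_le:
  assumes fin: "finite W"
    and "\<And>k. k \<in> set ks \<Longrightarrow> k \<in> W \<longleftrightarrow> a k \<in> W"
  shows "card (invariant_sets W (swap_prod a ks)) * 2 ^ card W
       \<le> 2 ^ length (filter (\<lambda>k. k \<in> W) ks) * (card (closed_sets W a ks))\<^sup>2"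
  using assms(2)
proof (induction ks)
  case Nil
  have I: "invariant_sets W (swap_prod a []) = Pow W" and C: "closed_sets W a [] = Pow W"
    by (auto simp: invariant_sets_def closed_sets_def)
  show ?case
    unfolding I C using fin by (simp add: card_Pow power2_eq_square)
next
  case (Cons k ks)
  let ?p = "swap_prod a ks"
  let ?I = "invariant_sets W ?p" and ?I' = "invariant_sets W (?p \<circ> transpose k (a k))"
  let ?C = "closed_sets W a ks" and ?C' = "closed_sets W a (k # ks)"
  let ?l = "length (filter (\<lambda>k. k \<in> W) ks)" and ?l' = "length (filter (\<lambda>k. k \<in> W) (k # ks))"
  have IH: "card ?I * 2 ^ card W \<le> 2 ^ ?l * (card ?C)\<^sup>2"
    using Cons by simp
  have C': "?C' = {X \<in> ?C. k \<in> X \<longleftrightarrow> a k \<in> X}"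
    by (auto simp: closed_sets_def)
  have "card ?I' * 2 ^ card W \<le> 2 ^ ?l' * (card ?C')\<^sup>2"
  proof (cases "\<exists>K\<in>?C. \<not> (k \<in> K \<longleftrightarrow> a k \<in> K)")
    case True
    then obtain K where K: "K \<in> ?C" "\<not> (k \<in> K \<longleftrightarrow> a k \<in> K)" by blast
    have KI: "K \<in> ?I" using K(1) closed_sets_invariant by blast
    have "k \<in> W"
      using K Cons.prems[of k] by (auto simp: closed_sets_def)
    then have l': "?l' = Suc ?l" by simp
    have "?I' = {X \<in> ?I'. k \<in> X \<longleftrightarrow> a k \<in> X}"
      using invariant_set_of_merge[OF bij_is_inj[OF bij_swap_prod] fin KI K(2)] by blast
    then have I': "?I' = {X \<in> ?I. k \<in> X \<longleftrightarrow> a k \<in> X}"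
      by (simp only: invariant_sets_comp_transpose)
    have "card ?I = 2 * card ?I'"
      unfolding I'
      using finite_invariant_sets[OF fin] sym_diff_invariant_sets KI K(2)
      by (rule card_sym_diff_closed_half)
    moreover have "card ?C = 2 * card ?C'"
      unfolding C'
      using finite_closed_sets[OF fin] sym_diff_closed_sets K
      by (rule card_sym_diff_closed_half)
    ultimately show ?thesis
      unfolding l' using IH by (simp add: power2_eq_square ac_simps)
  next
    case False
    then have CC: "?C' = ?C" using C' by blast
    show ?thesis
    proof (cases "k \<in> W")
      case True
      have "card ?I' * 2 ^ card W \<le> 2 * card ?I * 2 ^ card W"
        using card_invariant_sets_comp_transpose_le[OF fin] by (intro mult_right_mono) auto
      also have "\<dots> \<le> 2 * (2 ^ ?l * (card ?C)\<^sup>2)"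
        using IH by simp
      finally show ?thesis
        unfolding CC using True by simp
    next
      case False
      then have out: "k \<notin> X \<and> a k \<notin> X" if "X \<subseteq> W" for X
        using that Cons.prems[of k] by auto
      have "?I' = {X \<in> ?I'. k \<in> X \<longleftrightarrow> a k \<in> X}" "?I = {X \<in> ?I. k \<in> X \<longleftrightarrow> a k \<in> X}"
        using out by (auto simp: invariant_sets_def)
      then have "?I' = ?I"
        by (simp only: invariant_sets_comp_transpose)
      then show ?thesis
        unfolding CC using False IH by simp
    qed
  qed
  then show ?case unfolding swap_prod.simps .
qed

text \<open>The functional graph has exactly one edge for each vertex of \<open>W\<close>, so the genus inequality with
  a single component leaves room for two cycles, that is, for four invariant sets.\<close>

lemma card_invariant_sets_component:
  assumes fin: "finite W" and "distinct ks" "W \<subseteq> set ks"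
    and cl: "\<And>k. k \<in> set ks \<Longrightarrow> k \<in> W \<longleftrightarrow> a k \<in> W"
    and conn: "closed_sets W a ks \<subseteq> {{}, W}"
  shows "card (invariant_sets W (swap_prod a ks)) \<le> 4"
proof -
  have "{x \<in> set ks. x \<in> W} = W" using assms(3) by blast
  then have len: "length (filter (\<lambda>k. k \<in> W) ks) = card W"
    using assms(2) by (metis distinct_card distinct_filter set_filter)
  have "card (closed_sets W a ks) \<le> card {{}, W}"
    using conn by (intro card_mono) auto
  also have "\<dots> \<le> 2"
    by (cases "W = {}") auto
  finally have "(card (closed_sets W a ks))\<^sup>2 \<le> 2\<^sup>2"
    by (intro power_mono) auto
  then have "2 ^ card W * (card (closed_sets W a ks))\<^sup>2 \<le> 4 * 2 ^ card W"
    by simp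
  moreover have "card (invariant_sets W (swap_prod a ks)) * 2 ^ card W
      \<le> 2 ^ card W * (card (closed_sets W a ks))\<^sup>2"
    using card_invariant_sets_le[where ks = ks, OF fin, OF cl] by (simp only: len)
  ultimately have "card (invariant_sets W (swap_prod a ks)) * 2 ^ card W \<le> 4 * 2 ^ card W"
    by linarith
  then show ?thesis by simp
qed

lemma no_three_invariant_parts:
  assumes fin: "finite W" and "card (invariant_sets W p) \<le> 4"
    and "A \<in> invariant_sets W p" "B \<in> invariant_sets W p" "C \<in> invariant_sets W p"
    and ne: "A \<noteq> {}" "B \<noteq> {}" "C \<noteq> {}"
    and disj: "A \<inter> B = {}" "A \<inter> C = {}" "B \<inter> C = {}"
  shows False
proof -
  have "inj_on Union (Pow {A, B, C})"
  proof (rule inj_onI)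
    fix F G assume FG: "F \<in> Pow {A, B, C}" "G \<in> Pow {A, B, C}" "\<Union>F = \<Union>G"
    have sub: "F \<subseteq> G" if "F \<subseteq> {A, B, C}" "G \<subseteq> {A, B, C}" "\<Union>F = \<Union>G" for F G
    proof
      fix X assume X: "X \<in> F"
      have "X \<noteq> {}" using X \<open>F \<subseteq> {A, B, C}\<close> ne by auto
      then have "\<exists>x. x \<in> X" by blast
      then obtain x where x: "x \<in> X" ..
      then obtain Y where Y: "Y \<in> G" "x \<in> Y" using X \<open>\<Union>F = \<Union>G\<close> by blast
      have "X \<in> {A, B, C}" "Y \<in> {A, B, C}" using X Y \<open>F \<subseteq> {A, B, C}\<close> \<open>G \<subseteq> {A, B, C}\<close> by auto
      then have "X = Y" using x Y(2) disj by blast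
      then show "X \<in> G" using Y by simp
    qed
    show "F = G" using sub[of F G] sub[of G F] FG by auto
  qed
  then have "card (Union ` Pow {A, B, C}) = card (Pow {A, B, C})"
    by (rule card_image)
  moreover have "A \<noteq> B" "A \<noteq> C" "B \<noteq> C" using ne disj by auto
  ultimately have eight: "card (Union ` Pow {A, B, C}) = 8"
    by (simp add: card_Pow)
  have "Union ` Pow {A, B, C} \<subseteq> invariant_sets W p"
  proof (rule image_subsetI)
    fix F assume "F \<in> Pow {A, B, C}"
    then have "F \<subseteq> invariant_sets W p" using assms(3-5) by auto
    then have "\<forall>X\<in>F. X \<subseteq> W \<and> (\<forall>x. p x \<in> X \<longleftrightarrow> x \<in> X)"
      by (auto simp: invariant_sets_def)
    then show "\<Union>F \<in> invariant_sets W p"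
      unfolding invariant_sets_def by blast
  qed
  then have "card (Union ` Pow {A, B, C}) \<le> card (invariant_sets W p)"
    using finite_invariant_sets[OF fin] by (intro card_mono)
  then show False using eight assms(2) by simp
qed

text \<open>The component of \<open>x\<close> is the least closed set \<open>W\<close> containing \<open>x\<close>. It is
  connected: a closed subset and its complement in \<open>W\<close> are both closed, and the one that contains
  \<open>x\<close> is all of \<open>W\<close> by minimality.\<close>

lemma exists_component:
  assumes fin: "finite S" and a: "\<And>k. k \<in> S \<Longrightarrow> a k \<in> S" and x: "x \<in> S" and ks: "set ks = S"
  obtains W where "x \<in> W" "W \<subseteq> S" "\<And>k. k \<in> S \<Longrightarrow> k \<in> W \<longleftrightarrow> a k \<in> W"
    "closed_sets W a ks \<subseteq> {{}, W}"
proof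
  define W where "W = \<Inter>{X \<in> closed_sets S a ks. x \<in> X}"
  have S: "S \<in> {X \<in> closed_sets S a ks. x \<in> X}"
    using a x ks by (auto simp: closed_sets_def)
  show xW: "x \<in> W" by (auto simp: W_def)
  show WS: "W \<subseteq> S" using S by (auto simp: W_def)
  show cl: "k \<in> W \<longleftrightarrow> a k \<in> W" if "k \<in> S" for k
    using that ks by (auto simp: W_def closed_sets_def)
  show "closed_sets W a ks \<subseteq> {{}, W}"
  proof
    fix X assume X: "X \<in> closed_sets W a ks"
    have XW: "X \<subseteq> W" using X by (auto simp: closed_sets_def)
    have least: "W \<subseteq> Y" if "Y \<in> closed_sets S a ks" "x \<in> Y" for Y
      using that by (auto simp: W_def)
    show "X \<in> {{}, W}"
    proof (cases "x \<in> X")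
      case True
      have "X \<in> closed_sets S a ks"
        using X WS by (auto simp: closed_sets_def)
      then show ?thesis using least True XW by blast
    next
      case False
      have "W - X \<in> closed_sets S a ks"
        using X WS cl ks by (auto simp: closed_sets_def)
      then show ?thesis using least[of "W - X"] False xW XW by blast
    qed
  qed
qed

section \<open>Exchanging two adjacent blocks\<close>

definition restrict_perm :: "('a \<Rightarrow> 'a) \<Rightarrow> 'a set \<Rightarrow> 'a \<Rightarrow> 'a" where
  "restrict_perm p B x = (if x \<in> B then p x else x)"

lemma bij_restrict_perm:
  assumes p: "bij p" and B: "\<And>x. p x \<in> B \<longleftrightarrow> x \<in> B"
  shows "bij (restrict_perm p B)"
proof (rule bijI)
  show "inj (restrict_perm p B)"
  proof (rule injI)
    fix x y assume eq: "restrict_perm p B x = restrict_perm p B y"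
    have "x \<in> B \<longleftrightarrow> y \<in> B"
      using eq B[of x] B[of y] by (auto simp: restrict_perm_def split: if_splits)
    then show "x = y"
      using eq bij_is_inj[OF p] by (auto simp: restrict_perm_def inj_eq split: if_splits)
  qed
  show "surj (restrict_perm p B)"
  proof (rule surjI)
    fix y
    have "p (inv p y) = y" using p by (simp add: bij_is_surj surj_f_inv_f)
    then show "restrict_perm p B (if y \<in> B then inv p y else y) = y"
      using B[of "inv p y"] by (simp add: restrict_perm_def)
  qed
qed

text \<open>A transposition along an edge that leaves \<open>B2\<close> is conjugated by the restriction of \<open>p\<close> to \<open>B3\<close>,
  which moves its head only if the edge runs into \<open>B3\<close>; symmetrically for \<open>B3\<close>, but with the inverse.
  The asymmetry comes from rewriting \<open>A\<^sub>3 A\<^sub>2 = C D\<close> as \<open>(D A\<^sub>2 D\<inverse>) (C\<inverse> A\<^sub>3 C) = C D\<close>.\<close>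

definition twist :: "'a set \<Rightarrow> 'a set \<Rightarrow> ('a \<Rightarrow> 'a) \<Rightarrow> ('a \<Rightarrow> 'a) \<Rightarrow> 'a \<Rightarrow> 'a" where
  "twist B2 B3 p a k =
     (if k \<in> B2 then restrict_perm p B3 (a k)
      else if k \<in> B3 then inv (restrict_perm p B2) (a k)
      else a k)"

text \<open>The two-block computation
  needs \<open>A\<^sub>1\<close> and \<open>A\<^sub>4\<close> to be out of the way. They act
  trivially on each component that meets both exchanged blocks, and on the other components one of
  the exchanged factors acts trivially. Hence the two products are compared one point \<open>x\<close> at a time.\<close>

lemma twisted_product:
  fixes a :: "'a \<Rightarrow> 'a"
  assumes dist: "distinct (L1 @ L2 @ L3 @ L4)"
    and S: "S = set (L1 @ L2 @ L3 @ L4)"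
    and a: "\<And>k. k \<in> S \<Longrightarrow> a k \<in> S"
    and p: "p = swap_prod a (L1 @ L2 @ L3 @ L4)"
    and inv2: "\<And>x. p x \<in> set L2 \<longleftrightarrow> x \<in> set L2"
    and inv3: "\<And>x. p x \<in> set L3 \<longleftrightarrow> x \<in> set L3"
  shows "swap_prod (twist (set L2) (set L3) p a) (L1 @ L3 @ L2 @ L4) = p"
proof
  fix x
  let ?b = "twist (set L2) (set L3) p a"
  define C where "C = restrict_perm p (set L2)"
  define D where "D = restrict_perm p (set L3)"
  have bij_p: "bij p" unfolding p by (rule bij_swap_prod)
  have bij_C: "bij C" and bij_D: "bij D"
    unfolding C_def D_def using bij_p inv2 inv3 by (simp_all add: bij_restrict_perm)
  have D_fix: "D y = y" if "y \<notin> set L3" for y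
    using that by (simp add: D_def restrict_perm_def)
  have C_fix: "C y = y" if "y \<notin> set L2" for y
    using that by (simp add: C_def restrict_perm_def)
  have invC_fix: "inv C y = y" if "y \<notin> set L2" for y
    using C_fix[OF that] bij_C by (metis bij_inv_eq_iff)
  have invD_fix: "inv D y = y" if "y \<notin> set L3" for y
    using D_fix[OF that] bij_D by (metis bij_inv_eq_iff)
  have C_inv: "C (inv C y) = y" "inv C (C y) = y" and D_inv: "D (inv D y) = y" "inv D (D y) = y" for y
    using bij_C bij_D by (simp_all add: bij_is_inj bij_is_surj surj_f_inv_f)
  define A where "A = swap_prod a"
  have p': "p y = A L4 (A L3 (A L2 (A L1 y)))" for y
    by (simp add: p A_def swap_prod_append)
  have b1: "swap_prod ?b L1 = A L1" and b4: "swap_prod ?b L4 = A L4"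
    unfolding A_def using dist by (auto intro!: swap_prod_cong simp: twist_def)
  have b2: "swap_prod ?b L2 y = D (A L2 (inv D y))" for y
  proof -
    have fixL: "map D L2 = L2"
      using dist D_fix by (intro map_idI) auto
    have "swap_prod ?b (map D L2) (D (inv D y)) = D (swap_prod a L2 (inv D y))"
    proof (rule swap_prod_conj[OF bij_is_inj[OF bij_D]])
      fix k assume k: "k \<in> set L2"
      then have "D k = k" using dist D_fix by auto
      then show "?b (D k) = D (a k)" using k by (simp add: twist_def D_def)
    qed
    then show ?thesis by (simp add: fixL D_inv A_def)
  qed
  have b3: "swap_prod ?b L3 y = inv C (A L3 (C y))" for y
  proof -
    have fixL: "map (inv C) L3 = L3"
      using dist invC_fix by (intro map_idI) auto
    have "swap_prod ?b (map (inv C) L3) (inv C (C y)) = inv C (swap_prod a L3 (C y))"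
    proof (rule swap_prod_conj[OF bij_is_inj[OF bij_imp_bij_inv[OF bij_C]]])
      fix k assume k: "k \<in> set L3"
      then have "inv C k = k" and "k \<notin> set L2" using dist invC_fix by auto
      then show "?b (inv C k) = inv C (a k)" using k by (simp add: twist_def C_def)
    qed
    then show ?thesis by (simp add: fixL C_inv A_def)
  qed
  have b: "swap_prod ?b (L1 @ L3 @ L2 @ L4) y = A L4 (D (A L2 (inv D (inv C (A L3 (C (A L1 y)))))))" for y
    by (simp add: swap_prod_append b1 b2 b3 b4)
  show "swap_prod ?b (L1 @ L3 @ L2 @ L4) x = p x"
  proof (cases "x \<in> S")
    case False
    have trivial: "A L x = x" if "set L \<subseteq> S" for L
      unfolding A_def using that a False by (intro swap_prod_fixes_closed[of L "- S"]) auto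
    have "x \<notin> set L2" "x \<notin> set L3" using False S by auto
    then have "inv D x = x" "inv C x = x" "C x = x" "D x = x"
      using invD_fix invC_fix C_fix D_fix by simp_all
    moreover have "A L1 x = x" "A L2 x = x" "A L3 x = x" "A L4 x = x"
      using trivial S by auto
    ultimately show ?thesis
      unfolding b p' by simp
  next
    case True
    obtain W where W: "x \<in> W" "W \<subseteq> S" and cl: "\<And>k. k \<in> S \<Longrightarrow> k \<in> W \<longleftrightarrow> a k \<in> W"
      and conn: "closed_sets W a (L1 @ L2 @ L3 @ L4) \<subseteq> {{}, W}"
      using exists_component[of S a x "L1 @ L2 @ L3 @ L4"] a True S by (metis List.finite_set)
    have A_mem: "A L y \<in> W \<longleftrightarrow> y \<in> W" if "set L \<subseteq> S" for L y
      unfolding A_def using that cl by (intro swap_prod_mem_closed_iff) auto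
    have A_fix: "A L y = y" if "set L \<subseteq> S" "set L \<inter> W = {}" "y \<in> W" for L y
      unfolding A_def using that cl by (intro swap_prod_fixes_closed[of L W]) auto
    have sub: "set L1 \<subseteq> S" "set L2 \<subseteq> S" "set L3 \<subseteq> S" "set L4 \<subseteq> S"
      using S by auto
    have p_mem: "p y \<in> W \<longleftrightarrow> y \<in> W" for y
      using sub by (simp add: p' A_mem)
    have C_mem: "C y \<in> W \<longleftrightarrow> y \<in> W" and D_mem: "D y \<in> W \<longleftrightarrow> y \<in> W" for y
      using p_mem by (simp_all add: C_def D_def restrict_perm_def)
    have invC_mem: "inv C y \<in> W \<longleftrightarrow> y \<in> W" and invD_mem: "inv D y \<in> W \<longleftrightarrow> y \<in> W" for y
      using C_mem[of "inv C y"] D_mem[of "inv D y"] by (simp_all add: C_inv D_inv)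
    have finW: "finite W" using W(2) S by (auto intro: finite_subset)
    have y: "A L1 x \<in> W" using W(1) sub A_mem by simp
    consider "set L3 \<inter> W = {}" | "set L2 \<inter> W = {}"
      | "set L2 \<inter> W \<noteq> {}" "set L3 \<inter> W \<noteq> {}" by blast
    then show ?thesis
    proof cases
      case 1
      then have D_triv: "D z = z" "inv D z = z" if "z \<in> W" for z
        using that D_fix[of z] invD_fix[of z] by auto
      show ?thesis
        unfolding b p' using y sub by (simp add: A_fix[OF _ 1] C_mem C_inv D_triv A_mem)
    next
      case 2
      then have C_triv: "C z = z" "inv C z = z" if "z \<in> W" for z
        using that C_fix[of z] invC_fix[of z] by auto
      show ?thesis
        unfolding b p' using y sub
        by (simp add: A_fix[OF _ 2] A_mem C_triv D_inv invD_mem)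
    next
      case 3
      have W23: "W \<subseteq> set L2 \<union> set L3"
      proof (rule ccontr)
        assume "\<not> ?thesis"
        then have ne: "W - (set L2 \<union> set L3) \<noteq> {}" by blast
        have "card (invariant_sets W p) \<le> 4"
          unfolding p using card_invariant_sets_component[OF finW dist] W(2) S cl conn by blast
        moreover have "set L2 \<inter> W \<in> invariant_sets W p" "set L3 \<inter> W \<in> invariant_sets W p"
          "W - (set L2 \<union> set L3) \<in> invariant_sets W p"
          using inv2 inv3 p_mem by (auto simp: invariant_sets_def)
        ultimately show False
          using no_three_invariant_parts[OF finW _ _ _ _ 3 ne] dist by auto
      qed
      then have "set L1 \<inter> W = {}" "set L4 \<inter> W = {}" using dist by auto
      then have A1: "A L1 z = z" and A4: "A L4 z = z" if "z \<in> W" for z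
        using A_fix sub that by auto
      have disj: "set L2 \<inter> set L3 = {}" using dist by auto
      have pCD: "p z = C (D z)" and pDC: "p z = D (C z)" if "z \<in> W" for z
      proof -
        have z: "z \<in> set L2 \<union> set L3" using that W23 by blast
        then show "p z = C (D z)"
          using disj inv2[of z] inv3[of z] by (auto simp: C_def D_def restrict_perm_def)
        show "p z = D (C z)"
          using z disj inv2[of z] inv3[of z] by (auto simp: C_def D_def restrict_perm_def)
      qed
      \<comment> \<open>the argument at which the new product applies \<open>A L2\<close>; it is chosen so that the factor
        \<open>A L3\<close> can be cancelled from the old product at \<open>z\<close>\<close>
      define z where "z = inv D (inv C (A L3 (C x)))"
      have z: "z \<in> W"
        using W(1) sub by (simp add: z_def invD_mem invC_mem A_mem C_mem)
      have "A L3 (A L2 z) = p z"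
        using z sub by (simp add: p' A1 A4 A_mem)
      also have "\<dots> = A L3 (C x)"
        unfolding pCD[OF z] by (simp add: z_def D_inv C_inv)
      finally have "A L2 z = C x"
        unfolding A_def by (simp add: inj_eq[OF bij_is_inj[OF bij_swap_prod]])
      then have "swap_prod ?b (L1 @ L3 @ L2 @ L4) x = A L4 (D (C x))"
        unfolding b A1[OF W(1)] by (simp add: z_def)
      also have "\<dots> = p x"
        using A4[of "D (C x)"] W(1) pDC by (simp add: C_mem D_mem)
      finally show ?thesis .
    qed
  qed
qed

definition factorizations :: "'a list \<Rightarrow> ('a \<Rightarrow> 'a) \<Rightarrow> ('a \<Rightarrow> 'a) set" where
  "factorizations ks p = {a \<in> set ks \<rightarrow>\<^sub>E set ks. p = swap_prod a ks}"

lemma finite_factorizations: "finite (factorizations ks p)"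
  unfolding factorizations_def by (rule finite_subset[OF _ finite_PiE[of "set ks" "\<lambda>_. set ks"]]) auto

text \<open>The twist is injective because it post-composes \<open>a\<close> with a fixed permutation on each block. An
  inequality is enough, since exchanging the roles of the two blocks gives the reverse one.\<close>

lemma card_factorizations_exchange_le:
  assumes dist: "distinct (L1 @ L2 @ L3 @ L4)"
    and p: "bij p"
    and inv2: "\<And>x. p x \<in> set L2 \<longleftrightarrow> x \<in> set L2"
    and inv3: "\<And>x. p x \<in> set L3 \<longleftrightarrow> x \<in> set L3"
  shows "card (factorizations (L1 @ L2 @ L3 @ L4) p) \<le> card (factorizations (L1 @ L3 @ L2 @ L4) p)"
proof -
  define S where "S = set (L1 @ L2 @ L3 @ L4)"
  have S': "set (L1 @ L3 @ L2 @ L4) = S" by (auto simp: S_def)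
  define t where "t = twist (set L2) (set L3) p"
  let ?C = "restrict_perm p (set L2)" and ?D = "restrict_perm p (set L3)"
  have bij: "bij ?C" "bij ?D" using p inv2 inv3 by (simp_all add: bij_restrict_perm)
  have C_mem: "?C x \<in> S \<longleftrightarrow> x \<in> S" and D_mem: "?D x \<in> S \<longleftrightarrow> x \<in> S" for x
    using inv2 inv3 by (auto simp: restrict_perm_def S_def)
  have invC_mem: "inv ?C x \<in> S \<longleftrightarrow> x \<in> S" for x
    using C_mem[of "inv ?C x"] bij by (simp add: bij_is_surj surj_f_inv_f)
  have t_mem: "t a k \<in> S \<longleftrightarrow> a k \<in> S" for a k
    by (simp add: t_def twist_def D_mem invC_mem)
  have t_eq: "t a k = t b k \<longleftrightarrow> a k = b k" for a b k
    using bij bij_imp_bij_inv[OF bij(1)] by (simp add: t_def twist_def inj_eq bij_is_inj)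
  show ?thesis
  proof (rule card_inj_on_le)
    show "inj_on (\<lambda>a. restrict (t a) S) (factorizations (L1 @ L2 @ L3 @ L4) p)"
    proof (rule inj_onI)
      fix a b
      assume a: "a \<in> factorizations (L1 @ L2 @ L3 @ L4) p"
        and b: "b \<in> factorizations (L1 @ L2 @ L3 @ L4) p"
        and eq: "restrict (t a) S = restrict (t b) S"
      have "a \<in> S \<rightarrow>\<^sub>E S" "b \<in> S \<rightarrow>\<^sub>E S"
        using a b by (auto simp: factorizations_def S_def)
      then show "a = b"
      proof (rule PiE_ext)
        fix k assume "k \<in> S"
        then have "t a k = t b k" using fun_cong[OF eq, of k] by simp
        then show "a k = b k" by (simp add: t_eq)
      qed
    qed
    show "(\<lambda>a. restrict (t a) S) ` factorizations (L1 @ L2 @ L3 @ L4) p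
        \<subseteq> factorizations (L1 @ L3 @ L2 @ L4) p"
    proof (rule image_subsetI)
      fix a assume "a \<in> factorizations (L1 @ L2 @ L3 @ L4) p"
      then have aS: "a \<in> S \<rightarrow>\<^sub>E S" and pa: "p = swap_prod a (L1 @ L2 @ L3 @ L4)"
        by (auto simp: factorizations_def S_def)
      have "swap_prod (restrict (t a) S) (L1 @ L3 @ L2 @ L4) = swap_prod (t a) (L1 @ L3 @ L2 @ L4)"
        by (rule swap_prod_cong) (simp add: S' del: set_append)
      also have "\<dots> = p"
        unfolding t_def using aS by (intro twisted_product[OF dist S_def _ pa inv2 inv3]) auto
      finally have prod: "swap_prod (restrict (t a) S) (L1 @ L3 @ L2 @ L4) = p" .
      have "restrict (t a) S \<in> S \<rightarrow>\<^sub>E S"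
        using aS t_mem by auto
      then show "restrict (t a) S \<in> factorizations (L1 @ L3 @ L2 @ L4) p"
        unfolding factorizations_def S' using prod by simp
    qed
  qed (rule finite_factorizations)
qed

lemma card_factorizations_exchange:
  assumes dist: "distinct (L1 @ L2 @ L3 @ L4)"
    and p: "bij p"
    and inv2: "\<And>x. p x \<in> set L2 \<longleftrightarrow> x \<in> set L2"
    and inv3: "\<And>x. p x \<in> set L3 \<longleftrightarrow> x \<in> set L3"
  shows "card (factorizations (L1 @ L2 @ L3 @ L4) p) = card (factorizations (L1 @ L3 @ L2 @ L4) p)"
proof (rule antisym)
  have "distinct (L1 @ L3 @ L2 @ L4)" using dist by auto
  then show "card (factorizations (L1 @ L3 @ L2 @ L4) p) \<le> card (factorizations (L1 @ L2 @ L3 @ L4) p)"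
    using p inv3 inv2 by (rule card_factorizations_exchange_le)
qed (rule card_factorizations_exchange_le[OF assms])

section \<open>Relabelling and concatenation\<close>

lemma multiplicity_perm_eq_card_factorizations:
  "multiplicity_perm n p = card (factorizations [1..<Suc n] p)"
proof -
  have "set [1..<Suc n] = {1..n}" by auto
  then show ?thesis
    unfolding multiplicity_perm_def factorizations_def transp_prod_eq_swap_prod by simp
qed

lemma card_factorizations_relabel_le:
  assumes f: "bij f" and q: "\<And>x. q (f x) = f (p x)"
  shows "card (factorizations ks p) \<le> card (factorizations (map f ks) q)"
proof (rule card_inj_on_le)
  have inj: "inj f" using f by (rule bij_is_inj)
  let ?S = "set ks"
  let ?g = "\<lambda>a. restrict (\<lambda>k. f (a (inv f k))) (f ` ?S)"
  have g: "?g a (f k) = f (a k)" if "k \<in> ?S" for a k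
    using that inj by simp
  show "inj_on ?g (factorizations ks p)"
  proof (rule inj_onI)
    fix a b assume ab: "a \<in> factorizations ks p" "b \<in> factorizations ks p" and eq: "?g a = ?g b"
    have "a \<in> ?S \<rightarrow>\<^sub>E ?S" "b \<in> ?S \<rightarrow>\<^sub>E ?S" using ab by (auto simp: factorizations_def)
    then show "a = b"
    proof (rule PiE_ext)
      fix k assume "k \<in> ?S"
      then have "f (a k) = f (b k)" using g[of k a] g[of k b] eq by simp
      then show "a k = b k" using inj by (simp add: inj_eq)
    qed
  qed
  show "?g ` factorizations ks p \<subseteq> factorizations (map f ks) q"
  proof (rule image_subsetI)
    fix a assume "a \<in> factorizations ks p"
    then have aS: "a \<in> ?S \<rightarrow>\<^sub>E ?S" and pa: "p = swap_prod a ks"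
      by (auto simp: factorizations_def)
    have conj: "swap_prod (?g a) (map f ks) (f x) = f (swap_prod a ks x)" for x
      using inj g by (rule swap_prod_conj)
    have "q = swap_prod (?g a) (map f ks)"
    proof
      fix y
      obtain x where y: "y = f x" using bij_is_surj[OF f] by (metis surjD)
      show "q y = swap_prod (?g a) (map f ks) y"
        unfolding y conj q pa ..
    qed
    moreover have "?g a \<in> f ` ?S \<rightarrow>\<^sub>E f ` ?S"
      using aS inj by auto
    ultimately show "?g a \<in> factorizations (map f ks) q"
      by (simp add: factorizations_def)
  qed
qed (rule finite_factorizations)

lemma card_factorizations_relabel:
  assumes f: "bij f" and q: "\<And>x. q (f x) = f (p x)"
  shows "card (factorizations ks p) = card (factorizations (map f ks) q)"
proof (rule antisym)
  have f_inv: "f (inv f y) = y" "inv f (f x) = x" for x y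
    using f by (simp_all add: bij_is_inj bij_is_surj surj_f_inv_f)
  have "p (inv f y) = inv f (q y)" for y
    using q[of "inv f y"] by (metis f_inv)
  then have "card (factorizations (map f ks) q) \<le> card (factorizations (map (inv f) (map f ks)) p)"
    by (intro card_factorizations_relabel_le bij_imp_bij_inv f)
  also have "map (inv f) (map f ks) = ks"
    by (simp add: f_inv(2) comp_def)
  finally show "card (factorizations (map f ks) q) \<le> card (factorizations ks p)" .
qed (use assms in \<open>rule card_factorizations_relabel_le\<close>)

text \<open>The relabelling carries the positions of \<open>\<rho>\<^sub>1\<parallel>\<rho>\<^sub>3\<parallel>\<rho>\<^sub>2\<parallel>\<rho>\<^sub>4\<close> to those of
  \<open>\<rho>\<^sub>1\<parallel>\<rho>\<^sub>2\<parallel>\<rho>\<^sub>3\<parallel>\<rho>\<^sub>4\<close>.\<close>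

definition block_exchange :: "nat \<Rightarrow> nat \<Rightarrow> nat \<Rightarrow> nat \<Rightarrow> nat" where
  "block_exchange n m l x =
     (if x \<le> n then x else if x \<le> n + l then x + m else if x \<le> n + l + m then x - l else x)"

lemma bij_block_exchange: "bij (block_exchange n m l)"
  by (rule o_bij[where g = "block_exchange n l m"])
    (auto simp: block_exchange_def fun_eq_iff)

lemma map_block_exchange_upt:
  "map (block_exchange n1 n2 n3) [1..<Suc (n1 + n3 + n2 + n4)]
   = [1..<Suc n1] @ [Suc (n1 + n2)..<Suc (n1 + n2 + n3)] @ [Suc n1..<Suc (n1 + n2)]
     @ [Suc (n1 + n2 + n3)..<Suc (n1 + n2 + n3 + n4)]"
  (is "map ?f _ = _")
proof -
  have split: "[1..<Suc (n1 + n3 + n2 + n4)] = [1..<Suc n1] @ [Suc n1..<Suc (n1 + n3)]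
      @ [Suc (n1 + n3)..<Suc (n1 + n3 + n2)] @ [Suc (n1 + n3 + n2)..<Suc (n1 + n3 + n2 + n4)]"
    by (metis (no_types, lifting) One_nat_def Suc_le_mono add_Suc append.assoc le_add1
        plus_1_eq_Suc upt_add_eq_append)
  have m1: "map ?f [1..<Suc n1] = [1..<Suc n1]"
    by (intro map_idI) (auto simp: block_exchange_def)
  have m2: "map ?f [Suc n1..<Suc (n1 + n3)] = [Suc (n1 + n2)..<Suc (n1 + n2 + n3)]"
    by (rule nth_equalityI) (auto simp: block_exchange_def simp del: upt_Suc)
  have m3: "map ?f [Suc (n1 + n3)..<Suc (n1 + n3 + n2)] = [Suc n1..<Suc (n1 + n2)]"
    by (rule nth_equalityI) (auto simp: block_exchange_def simp del: upt_Suc)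
  have m4: "map ?f [Suc (n1 + n3 + n2)..<Suc (n1 + n3 + n2 + n4)]
      = [Suc (n1 + n2 + n3)..<Suc (n1 + n2 + n3 + n4)]"
    by (rule nth_equalityI) (auto simp: block_exchange_def simp del: upt_Suc)
  show ?thesis
    unfolding split map_append m1 m2 m3 m4 ..
qed

lemma permutes_atMost_iff:
  assumes "p permutes {1..n}"
  shows "p j \<le> n \<longleftrightarrow> j \<le> (n::nat)"
  using permutes_in_image[OF assms, of j] permutes_not_in[OF assms, of j]
  by (cases "j = 0"; cases "j \<le> n") auto

lemma permutes_zero_iff:
  assumes "p permutes {1..n}"
  shows "p j = 0 \<longleftrightarrow> j = (0::nat)"
  using permutes_in_image[OF assms, of j] permutes_not_in[OF assms, of j]
  by (cases "j \<in> {1..n}") auto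

lemma perm_concat_le_iff:
  assumes p: "p permutes {1..n}" and r: "r permutes {1..m}"
  shows "perm_concat n p r j \<le> n \<longleftrightarrow> j \<le> n"
  using permutes_atMost_iff[OF p, of j] permutes_zero_iff[OF r, of "j - n"]
  by (auto simp: perm_concat_def)

theorem theorem10:
  fixes n1 n2 n3 n4 :: nat
    and r1 r2 r3 r4 :: "nat \<Rightarrow> nat"
  assumes "r1 permutes {1..n1}"
    and "r2 permutes {1..n2}"
    and "r3 permutes {1..n3}"
    and "r4 permutes {1..n4}"
  shows "multiplicity_perm (n1 + n2 + n3 + n4)
           (perm_concat n1 r1 (perm_concat n2 r2 (perm_concat n3 r3 r4)))
       = multiplicity_perm (n1 + n3 + n2 + n4)
           (perm_concat n1 r1 (perm_concat n3 r3 (perm_concat n2 r2 r4)))"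
proof -
  let ?p = "perm_concat n1 r1 (perm_concat n2 r2 (perm_concat n3 r3 r4))"
  let ?q = "perm_concat n1 r1 (perm_concat n3 r3 (perm_concat n2 r2 r4))"
  let ?f = "block_exchange n1 n2 n3"
  let ?L1 = "[1..<Suc n1]" and ?L2 = "[Suc n1..<Suc (n1 + n2)]"
    and ?L3 = "[Suc (n1 + n2)..<Suc (n1 + n2 + n3)]"
    and ?L4 = "[Suc (n1 + n2 + n3)..<Suc (n1 + n2 + n3 + n4)]"
  note r34 = perm_concat_permutes[OF assms(3,4)]
  note r234 = perm_concat_permutes[OF assms(2) r34]
  note r12 = perm_concat_permutes[OF assms(1,2)]
  note r123 = perm_concat_permutes[OF r12 assms(3)]
  have le1: "?p x \<le> n1 \<longleftrightarrow> x \<le> n1" for x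
    by (rule perm_concat_le_iff[OF assms(1) r234])
  have le2: "?p x \<le> n1 + n2 \<longleftrightarrow> x \<le> n1 + n2" for x
    using perm_concat_le_iff[OF r12 r34] by (simp only: perm_concat_assoc)
  have le3: "?p x \<le> n1 + n2 + n3 \<longleftrightarrow> x \<le> n1 + n2 + n3" for x
    using perm_concat_le_iff[OF r123 assms(4)]
      perm_concat_assoc[of "n1 + n2" n3 "perm_concat n1 r1 r2" r3 r4]
      perm_concat_assoc[of n1 n2 r1 r2 "perm_concat n3 r3 r4"] by simp
  have mem2: "?p x \<in> set ?L2 \<longleftrightarrow> x \<in> set ?L2" for x
    using le1[of x] le2[of x] by (simp del: upt_Suc) linarith
  have mem3: "?p x \<in> set ?L3 \<longleftrightarrow> x \<in> set ?L3" for x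
    using le2[of x] le3[of x] by (simp del: upt_Suc) linarith
  have bij: "bij ?p"
    using perm_concat_permutes[OF assms(1) r234] by (rule permutes_bij)
  have conj: "?p (?f x) = ?f (?q x)" for x
  proof -
    have b1: "r1 x \<le> n1" if "x \<le> n1" using that permutes_atMost_iff[OF assms(1)] by simp
    have b2: "r2 y \<le> n2 \<longleftrightarrow> y \<le> n2" "r2 y = 0 \<longleftrightarrow> y = 0" for y
      using permutes_atMost_iff[OF assms(2)] permutes_zero_iff[OF assms(2)] by auto
    have b3: "r3 y \<le> n3 \<longleftrightarrow> y \<le> n3" "r3 y = 0 \<longleftrightarrow> y = 0" for y
      using permutes_atMost_iff[OF assms(3)] permutes_zero_iff[OF assms(3)] by auto
    have b4: "r4 y = 0 \<longleftrightarrow> y = 0" for y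
      using permutes_zero_iff[OF assms(4)] by auto
    consider "x \<le> n1" | y where "x = n1 + y" "0 < y" "y \<le> n3"
      | y where "x = n1 + n3 + y" "0 < y" "y \<le> n2"
      | y where "x = n1 + n3 + n2 + y" "0 < y"
    proof -
      have "x \<le> n1 \<or> (\<exists>y. x = n1 + y \<and> 0 < y \<and> y \<le> n3)
          \<or> (\<exists>y. x = n1 + n3 + y \<and> 0 < y \<and> y \<le> n2) \<or> (\<exists>y. x = n1 + n3 + n2 + y \<and> 0 < y)"
        by presburger
      then show ?thesis using that by blast
    qed
    then show ?thesis
    proof cases
      case 1
      then show ?thesis using b1 by (simp add: perm_concat_def block_exchange_def)
    next
      case 2
      then show ?thesis
        using b3[of y] by (auto simp: perm_concat_def block_exchange_def)
    next
      case 3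
      then show ?thesis
        using b2[of y] by (auto simp: perm_concat_def block_exchange_def)
    next
      case 4
      then show ?thesis
        using b4[of y] by (auto simp: perm_concat_def block_exchange_def)
    qed
  qed
  have upt: "[1..<Suc (n1 + n2 + n3 + n4)] = ?L1 @ ?L2 @ ?L3 @ ?L4"
    by (metis (no_types, lifting) One_nat_def Suc_le_mono add_Suc append.assoc le_add1
        plus_1_eq_Suc upt_add_eq_append)
  have "multiplicity_perm (n1 + n2 + n3 + n4) ?p = card (factorizations (?L1 @ ?L2 @ ?L3 @ ?L4) ?p)"
    unfolding multiplicity_perm_eq_card_factorizations upt ..
  also have "\<dots> = card (factorizations (?L1 @ ?L3 @ ?L2 @ ?L4) ?p)"
    by (rule card_factorizations_exchange[OF _ bij mem2 mem3]) (auto simp del: upt_Suc)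
  also have "\<dots> = card (factorizations [1..<Suc (n1 + n3 + n2 + n4)] ?q)"
    unfolding map_block_exchange_upt[symmetric]
    using bij_block_exchange conj by (rule card_factorizations_relabel[symmetric])
  also have "\<dots> = multiplicity_perm (n1 + n3 + n2 + n4) ?q"
    by (rule multiplicity_perm_eq_card_factorizations[symmetric])
  finally show ?thesis .
qed

end
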